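(* There is an absolute constant $C$ such that for every integer $n\ge2$, for the $n$-adic filtration $\mathcal D$ of $[0,1]$, every weight $w$ on $[0,1]$, and every $f\in L^2(w)$ with $\int_0^1 f=0$, $$\|f\|_{L^2(w)}\le C\,n\,[w]_{\infty,\mathrm{scl}}^{1/2}\,\|Sf\|_{L^2(w)}.$$
   Context: $[0,1]$ carries Lebesgue measure, $|I|$ denotes length and $\langle f\rangle_I=|I|^{-1}\int_I f$. The $n$-adic filtration: $\mathcal D_0=\{[0,1]\}$ and each interval of $\mathcal D_k$ is split into $n$ consecutive subintervals of equal length (its children $\mathrm{ch}(I)$), forming $\mathcal D_{k+1}$; $\mathcal D=\bigcup_k\mathcal D_k$. Martingale differences: $\Delta_I f=\sum_{I'\in\mathrm{ch}(I)}\langle f\rangle_{I'}\mathbf 1_{I'}-\langle f\rangle_I\mathbf 1_I$; square function $Sf=\big(\sum_{I\in\mathcal D}(\Delta_If)^2\big)^{1/2}$. A weight is an integrable function $w>0$ a.e.; $\|f\|_{L^2(w)}^2=\int_0^1|f|^2w$. Localized maximal function: $M_If(x)=\mathbf 1_I(x)\sup_{J\subseteq I,\,x\in J}|\langle f\rangle_J|$, supremum over all intervals $J\subseteq I$ containing $x$. Semiclassical $A_\infty$ characteristic: $[w]_{\infty,\mathrm{scl}}=\sup_{I\in\mathcal D}\langle M_Iw\rangle_I/\langle w\rangle_I$. *)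

theory Defs
  imports "HOL-Analysis.Analysis"
begin

definition esqrt :: "ennreal \<Rightarrow> ennreal" where
  "esqrt x = (if x = \<infinity> then \<infinity> else ennreal (sqrt (enn2real x)))"

definition avg :: "(real \<Rightarrow> real) \<Rightarrow> real set \<Rightarrow> real" where
  "avg f I = (\<integral>x\<in>I. f x \<partial>lborel) / measure lborel I"

text \<open>The n-adic interval number j of generation k (j < n^k):
  [j/n^k, (j+1)/n^k).  Generation 0 is [0,1) (equal to [0,1] up to a null set).\<close>
definition nadic :: "nat \<Rightarrow> nat \<Rightarrow> nat \<Rightarrow> real set" where
  "nadic n k j = {real j / real n ^ k ..< (real j + 1) / real n ^ k}"

definition nadic_intervals :: "nat \<Rightarrow> real set set" where
  "nadic_intervals n = {nadic n k j | k j. j < n ^ k}"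

text \<open>Martingale difference Delta_I f for I = nadic n k j; its children are
  nadic n (k+1) (n*j+i), i < n.\<close>
definition mart_diff :: "nat \<Rightarrow> nat \<Rightarrow> nat \<Rightarrow> (real \<Rightarrow> real) \<Rightarrow> real \<Rightarrow> real" where
  "mart_diff n k j f x =
     (\<Sum>i<n. avg f (nadic n (Suc k) (n * j + i)) * indicator (nadic n (Suc k) (n * j + i)) x)
     - avg f (nadic n k j) * indicator (nadic n k j) x"

definition sq_fun_sq :: "nat \<Rightarrow> (real \<Rightarrow> real) \<Rightarrow> real \<Rightarrow> ennreal" where
  "sq_fun_sq n f x = (\<Sum>k. \<Sum>j<n ^ k. ennreal ((mart_diff n k j f x)\<^sup>2))"

definition sq_fun :: "nat \<Rightarrow> (real \<Rightarrow> real) \<Rightarrow> real \<Rightarrow> ennreal" where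
  "sq_fun n f x = esqrt (sq_fun_sq n f x)"

definition L2w_norm :: "(real \<Rightarrow> real) \<Rightarrow> (real \<Rightarrow> ennreal) \<Rightarrow> ennreal" where
  "L2w_norm w g = esqrt (\<integral>\<^sup>+ x\<in>{0..1}. (g x)\<^sup>2 * ennreal (w x) \<partial>lborel)"

definition loc_max :: "real set \<Rightarrow> (real \<Rightarrow> real) \<Rightarrow> real \<Rightarrow> ennreal" where
  "loc_max I f x = (if x \<in> I then
      (SUP J\<in>{J. \<exists>a b. a < b \<and> (J = {a..b} \<or> J = {a<..<b} \<or> J = {a..<b} \<or> J = {a<..b})
                    \<and> J \<subseteq> I \<and> x \<in> J}. ennreal \<bar>avg f J\<bar>)
    else 0)"

definition Ainf_scl :: "nat \<Rightarrow> (real \<Rightarrow> real) \<Rightarrow> ennreal" where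
  "Ainf_scl n w = (SUP I\<in>nadic_intervals n.
      ((\<integral>\<^sup>+ x\<in>I. loc_max I w x \<partial>lborel) / ennreal (measure lborel I)) / ennreal (avg w I))"

end

theory Submission
  imports Defs
begin

text \<open>
  Let \<open>f\<^sub>N\<close> be the conditional expectation of \<open>f\<close> on generation \<open>N\<close>. Writing \<open>X\<close> for the integral of
  \<open>f\<^sub>N\<^sup>2 w\<close> and expanding one factor into martingale differences gives \<open>X = \<Sum> d\<^sub>i (v\<^sub>i - c)\<close>, where
  \<open>d\<^sub>i\<close> is the value of \<open>\<Delta>\<^sub>J f\<close> on the \<open>i\<close>-th child of \<open>J\<close>, \<open>v\<^sub>i\<close> is the integral of \<open>f\<^sub>N w\<close> over that child,
  and \<open>c\<close> depends only on \<open>J\<close>. By Cauchy-Schwarz it suffices to bound \<open>\<Sum> (v\<^sub>i - c)\<^sup>2 / w\<^sub>i\<close>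
  by a multiple of \<open>X\<close>, \<open>w\<^sub>i\<close> being the masses of the children. With \<open>c = (v\<^sub>J / w\<^sub>J) min\<^sub>i w\<^sub>i\<close> this
  splits into a weighted martingale square function, which is orthogonal, and an embedding sum with
  coefficients \<open>a\<^sub>J = \<Sum>\<^sub>i (w\<^sub>i - min w)\<^sup>2 / w\<^sub>i\<close>. The Carleson condition for \<open>a\<^sub>J\<close> follows from a
  Bellman function argument that compares their sum with the \<open>n\<close>-adic maximal function of \<open>w\<close>.
  Finally \<open>N \<rightarrow> \<infinity>\<close> by Lebesgue differentiation and Fatou's lemma.
\<close>

section \<open>Estimates on the tree of intervals\<close>

text \<open>Each index below \<open>n ^ Suc k\<close> is \<open>n * j + i\<close> for exactly one
  parent \<open>j\<close> and one position \<open>i < n\<close>. All trees below number their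
  children in this way.\<close>

lemma sum_lessThan_power_Suc:
  fixes g :: "nat \<Rightarrow> 'a::comm_monoid_add"
  shows "(\<Sum>j<n ^ Suc k. g j) = (\<Sum>j<n ^ k. \<Sum>i<n. g (n * j + i))"
proof -
  have "(\<Sum>j<n ^ Suc k. g j) = (\<Sum>j<n ^ k. sum g {j * n..<j * n + n})"
    by (simp add: sum.nat_group mult.commute)
  also have "\<dots> = (\<Sum>j<n ^ k. \<Sum>i<n. g (n * j + i))"
  proof (rule sum.cong[OF refl])
    fix j
    show "sum g {j * n..<j * n + n} = (\<Sum>i<n. g (n * j + i))"
      using sum.shift_bounds_nat_ivl[of g 0 "j * n" n]
      by (simp add: lessThan_atLeast0 mult.commute add.commute)
  qed
  finally show ?thesis .
qed

lemma child_index_less: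
  fixes n j i k :: nat
  assumes "j < n ^ k" "i < n"
  shows "n * j + i < n ^ Suc k"
proof -
  have "n * j + i < n * Suc j" using assms by simp
  also have "\<dots> \<le> n * n ^ k" using assms(1) by (intro mult_le_mono2) simp
  finally show ?thesis by simp
qed

section \<open>Oscillation of the masses of the children\<close>

definition osc :: "nat \<Rightarrow> (nat \<Rightarrow> real) \<Rightarrow> real" where
  "osc n x = (\<Sum>i<n. (x i - Min (x ` {..<n}))\<^sup>2 / x i)"

lemma osc_nonneg: "(\<And>i. i < n \<Longrightarrow> 0 < x i) \<Longrightarrow> 0 \<le> osc n x"
  unfolding osc_def by (intro sum_nonneg) (simp add: less_imp_le)

lemma osc_scale:
  fixes x :: "nat \<Rightarrow> real"
  assumes "0 < n" "0 < c" "\<And>i. i < n \<Longrightarrow> 0 < x i"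
  shows "osc n (\<lambda>i. x i / c) = osc n x / c"
proof -
  have "Min ((\<lambda>i. x i / c) ` {..<n}) = Min (x ` {..<n}) / c"
  proof -
    have "mono (\<lambda>t::real. t / c)" using assms(2) by (auto simp: mono_def divide_right_mono)
    from mono_Min_commute[OF this, of "x ` {..<n}"] show ?thesis
      using assms(1) by (simp add: image_image lessThan_empty_iff)
  qed
  then show ?thesis
    using assms unfolding osc_def
    by (simp add: sum_divide_distrib diff_divide_distrib[symmetric] power_divide power2_eq_square mult.commute)
qed

text \<open>With x = p^2, m = q^2 and q <= p, one has (x - m)^2 / x <= 4 (p - q)^2 because p + q <=
  2 p. Comparing p and q with the free value \<open>s\<close> costs the factor \<open>n\<close>,
  since the deviation of the minimising child enters \<open>n\<close> times.\<close>

lemma osc_le_sqrt_deviation: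
  fixes x :: "nat \<Rightarrow> real"
  assumes n: "0 < n" and pos: "\<And>i. i < n \<Longrightarrow> 0 < x i"
  shows "osc n x \<le> 16 * real n * (\<Sum>i<n. (sqrt (x i) - s)\<^sup>2)"
proof -
  define m where "m = Min (x ` {..<n})"
  define S where "S = (\<Sum>i<n. (sqrt (x i) - s)\<^sup>2)"
  have "m \<in> x ` {..<n}" unfolding m_def using n by (intro Min_in) auto
  then obtain l where l: "l < n" "m = x l" by auto
  have mpos: "0 < m" using l pos by simp
  have mS: "(sqrt m - s)\<^sup>2 \<le> S"
    unfolding S_def l(2) by (rule member_le_sum) (use l in auto)
  have le: "(x i - m)\<^sup>2 / x i \<le> 8 * (sqrt (x i) - s)\<^sup>2 + 8 * (sqrt m - s)\<^sup>2" if i: "i < n" for i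
  proof -
    have mle: "m \<le> x i" unfolding m_def using i by (intro Min_le) auto
    have xpos: "0 < x i" by (rule pos[OF i])
    define p q where "p = sqrt (x i)" and "q = sqrt m"
    have pq: "0 < q" "q \<le> p" "x i = p\<^sup>2" "m = q\<^sup>2"
      using mle mpos xpos unfolding p_def q_def by auto
    have "(p + q)\<^sup>2 \<le> (2 * p)\<^sup>2" using pq by (intro power_mono) auto
    then have "(p - q)\<^sup>2 * (p + q)\<^sup>2 \<le> (p - q)\<^sup>2 * (2 * p)\<^sup>2" by (intro mult_left_mono) auto
    moreover have "(p\<^sup>2 - q\<^sup>2)\<^sup>2 = (p - q)\<^sup>2 * (p + q)\<^sup>2" by (simp add: power2_eq_square algebra_simps)
    ultimately have "(x i - m)\<^sup>2 \<le> 4 * (p - q)\<^sup>2 * x i" using pq by (simp add: power_mult_distrib)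
    then have "(x i - m)\<^sup>2 / x i \<le> 4 * (p - q)\<^sup>2" using xpos by (simp add: divide_le_eq)
    also have "\<dots> \<le> 8 * (p - s)\<^sup>2 + 8 * (q - s)\<^sup>2"
    proof -
      have "0 \<le> 4 * ((p - s) + (q - s))\<^sup>2" by simp
      then show ?thesis by (simp add: power2_eq_square algebra_simps)
    qed
    finally show ?thesis unfolding p_def q_def .
  qed
  have "osc n x \<le> (\<Sum>i<n. 8 * (sqrt (x i) - s)\<^sup>2 + 8 * (sqrt m - s)\<^sup>2)"
    unfolding osc_def m_def[symmetric] by (intro sum_mono) (use le in auto)
  also have "\<dots> = 8 * S + 8 * real n * (sqrt m - s)\<^sup>2"
    by (simp add: sum.distrib S_def sum_distrib_left)
  also have "\<dots> \<le> 8 * S + 8 * real n * S" using mS by (intro add_left_mono mult_left_mono) auto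
  also have "\<dots> \<le> 16 * real n * S"
  proof -
    have "0 \<le> S" unfolding S_def by (intro sum_nonneg) auto
    then have "1 * S \<le> real n * S" using n by (intro mult_right_mono) auto
    then show ?thesis by linarith
  qed
  finally show ?thesis unfolding S_def .
qed

text \<open>As the mean is \<open>a\<close>, expanding the squares leaves 2 sqrt a times the sum of
  sqrt a - sqrt (x i). That sum is therefore nonnegative, and sqrt a may be raised to sqrt
  M.\<close>

lemma sqrt_deviation_le:
  fixes x :: "nat \<Rightarrow> real"
  assumes pos: "\<And>i. i < n \<Longrightarrow> 0 < x i" and mean: "(\<Sum>i<n. x i) = real n * a"
    and a: "0 < a" "a \<le> M"
  shows "(\<Sum>i<n. (sqrt (x i) - sqrt a)\<^sup>2) \<le> 2 * (\<Sum>i<n. sqrt (a * M) - sqrt (x i * M))"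
proof -
  define D where "D = (\<Sum>i<n. sqrt a - sqrt (x i))"
  have "(\<Sum>i<n. (sqrt (x i) - sqrt a)\<^sup>2) = (\<Sum>i<n. x i + a - 2 * sqrt a * sqrt (x i))"
    using pos a by (intro sum.cong) (auto simp: power2_diff less_imp_le)
  also have "\<dots> = (\<Sum>i<n. x i) + (\<Sum>i<n. 2 * a - 2 * sqrt a * sqrt (x i)) - real n * a"
    by (simp add: sum.distrib sum_subtractf)
  also have "\<dots> = (\<Sum>i<n. 2 * sqrt a * (sqrt a - sqrt (x i)))"
    using a by (simp add: mean right_diff_distrib mult.assoc)
  also have "\<dots> = 2 * sqrt a * D" by (simp add: D_def sum_distrib_left)
  finally have eq: "(\<Sum>i<n. (sqrt (x i) - sqrt a)\<^sup>2) = 2 * sqrt a * D" .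
  have "0 \<le> 2 * sqrt a * D" unfolding eq[symmetric] by (intro sum_nonneg) auto
  then have D: "0 \<le> D" using a by (simp add: zero_le_mult_iff)
  have "2 * sqrt a * D \<le> 2 * sqrt M * D" using D a by (intro mult_right_mono) auto
  also have "\<dots> = 2 * (\<Sum>i<n. sqrt (a * M) - sqrt (x i * M))"
    by (simp add: D_def sum_distrib_left real_sqrt_mult algebra_simps)
  finally show ?thesis unfolding eq .
qed

section \<open>Recursive sums over finite subtrees\<close>

primrec leaf_sum :: "nat \<Rightarrow> (nat \<Rightarrow> real) \<Rightarrow> nat \<Rightarrow> nat \<Rightarrow> real" where
  "leaf_sum n g 0 j = g j"
| "leaf_sum n g (Suc d) j = (\<Sum>i<n. leaf_sum n g d (n * j + i))"

text \<open>Depth \<open>d\<close> takes in the generations k to k + d - 1 only, since the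
  coefficient at a node already looks at the children.\<close>

primrec tree_sum :: "nat \<Rightarrow> (nat \<Rightarrow> nat \<Rightarrow> real) \<Rightarrow> nat \<Rightarrow> nat \<Rightarrow> nat \<Rightarrow> real" where
  "tree_sum n a 0 k j = 0"
| "tree_sum n a (Suc d) k j = a k j + (\<Sum>i<n. tree_sum n a d (Suc k) (n * j + i))"

text \<open>When \<open>W\<close> holds the averages of a weight, this is the integral over the
  interval (k, j) of a truncated n-adic maximal function: it starts with the value \<open>M\<close>
  and takes in \<open>d\<close> further generations. A leaf contributes its value times its
  length.\<close>

primrec max_sum :: "nat \<Rightarrow> (nat \<Rightarrow> nat \<Rightarrow> real) \<Rightarrow> nat \<Rightarrow> nat \<Rightarrow> nat \<Rightarrow> real \<Rightarrow> real" where
  "max_sum n W 0 k j M = M / real n ^ k"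
| "max_sum n W (Suc d) k j M =
     (\<Sum>i<n. max_sum n W d (Suc k) (n * j + i) (max M (W (Suc k) (n * j + i))))"

lemma tree_sum_nonneg:
  assumes "\<And>k j. j < n ^ k \<Longrightarrow> 0 \<le> a k j" "j < n ^ k"
  shows "0 \<le> tree_sum n a d k j"
  using assms(2)
proof (induction d arbitrary: k j)
  case (Suc d)
  then show ?case
    by (auto intro!: add_nonneg_nonneg sum_nonneg assms(1) Suc.IH child_index_less simp del: power_Suc)
qed simp

lemma tree_sum_root: "tree_sum n a N 0 0 = (\<Sum>k<N. \<Sum>j<n ^ k. a k j)"
proof -
  \<comment> \<open>Summed over a whole generation, with \<open>k\<close> arbitrary, the identity
    admits induction on the depth.\<close>
  have "(\<Sum>j<n ^ k. tree_sum n a d k j) = (\<Sum>l<d. \<Sum>j<n ^ (k + l). a (k + l) j)" for d k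
  proof (induction d arbitrary: k)
    case (Suc d)
    have "(\<Sum>j<n ^ k. tree_sum n a (Suc d) k j)
        = (\<Sum>j<n ^ k. a k j) + (\<Sum>j<n ^ Suc k. tree_sum n a d (Suc k) j)"
      by (simp add: sum.distrib sum_lessThan_power_Suc del: power_Suc)
    then show ?case
      by (simp add: Suc.IH sum.lessThan_Suc_shift del: power_Suc sum.lessThan_Suc)
  qed simp
  from this[of N 0] show ?thesis by simp
qed

lemma leaf_sum_root: "leaf_sum n g N 0 = (\<Sum>j<n ^ N. g j)"
proof -
  have "(\<Sum>j<n ^ k. leaf_sum n g d j) = (\<Sum>j<n ^ (k + d). g j)" for d k
  proof (induction d arbitrary: k)
    case (Suc d)
    have "(\<Sum>j<n ^ k. leaf_sum n g (Suc d) j) = (\<Sum>j<n ^ Suc k. leaf_sum n g d j)"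
      by (simp add: sum_lessThan_power_Suc del: power_Suc)
    then show ?case by (simp add: Suc.IH del: power_Suc)
  qed simp
  from this[of N 0] show ?thesis by simp
qed

text \<open>Only the masses of intervals enter the tree estimates, so these are stated for arbitrary
  positive additive masses.\<close>

locale mass_tree =
  fixes n :: nat and w :: "nat \<Rightarrow> nat \<Rightarrow> real"
  assumes n_pos: "0 < n"
    and pos: "j < n ^ k \<Longrightarrow> 0 < w k j"
    and additive: "j < n ^ k \<Longrightarrow> w k j = (\<Sum>i<n. w (Suc k) (n * j + i))"
begin

definition density :: "nat \<Rightarrow> nat \<Rightarrow> real" where
  "density k j = real n ^ k * w k j"

definition child_osc :: "nat \<Rightarrow> nat \<Rightarrow> real" where
  "child_osc k j = osc n (\<lambda>i. w (Suc k) (n * j + i))"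

lemma child_pos: "j < n ^ k \<Longrightarrow> i < n \<Longrightarrow> 0 < w (Suc k) (n * j + i)"
  by (intro pos child_index_less)

lemma density_pos: "j < n ^ k \<Longrightarrow> 0 < density k j"
  using pos n_pos by (simp add: density_def)

lemma density_mean:
  "j < n ^ k \<Longrightarrow> (\<Sum>i<n. density (Suc k) (n * j + i)) = real n * density k j"
  by (simp add: density_def additive sum_distrib_left algebra_simps)

lemma child_osc_nonneg: "j < n ^ k \<Longrightarrow> 0 \<le> child_osc k j"
  unfolding child_osc_def by (intro osc_nonneg child_pos)

text \<open>Scaled from masses to averages, the children have mean \<open>density k j\<close>, so
  the two square root estimates combine with s = sqrt (density k j). The constant 32 is 16 times
  2.\<close>

lemma child_osc_le:
  assumes j: "j < n ^ k" and M: "density k j \<le> M"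
  shows "child_osc k j \<le> 32 * real n / real n ^ Suc k *
           (\<Sum>i<n. sqrt (density k j * M) - sqrt (density (Suc k) (n * j + i) * M))"
proof -
  let ?x = "\<lambda>i. density (Suc k) (n * j + i)"
  have xpos: "0 < ?x i" if "i < n" for i using j that by (intro density_pos child_index_less)
  have "child_osc k j = osc n (\<lambda>i. ?x i / real n ^ Suc k)"
    using n_pos by (simp add: child_osc_def density_def)
  also have "\<dots> = osc n ?x / real n ^ Suc k"
    using n_pos xpos by (intro osc_scale) auto
  also have "\<dots> \<le> (16 * real n * (\<Sum>i<n. (sqrt (?x i) - sqrt (density k j))\<^sup>2)) / real n ^ Suc k"
    by (intro divide_right_mono osc_le_sqrt_deviation n_pos xpos) auto
  also have "\<dots> \<le> (16 * real n * (2 * (\<Sum>i<n. sqrt (density k j * M) - sqrt (?x i * M)))) / real n ^ Suc k"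
    by (intro divide_right_mono mult_left_mono sqrt_deviation_le xpos density_mean j M density_pos) auto
  finally show ?thesis by (simp only: mult.assoc times_divide_eq_left)
qed

text \<open>The Bellman function is \<open>M - sqrt (W * M)\<close> for the density \<open>W\<close> and its running maximum \<open>M\<close>:
  a step with frozen \<open>M\<close> pays for the oscillation, and raising \<open>M\<close> to \<open>W\<close> never costs anything.\<close>

lemma tree_sum_child_osc_le_aux:
  assumes "j < n ^ k" "density k j \<le> M"
  shows "tree_sum n child_osc d k j
     \<le> 32 * real n * (max_sum n density d k j M - (M - sqrt (density k j * M)) / real n ^ k)"
  using assms
proof (induction d arbitrary: k j M)
  case 0
  then have "0 \<le> sqrt (density k j * M)" using density_pos[of j k] by simp
  then show ?case by (simp add: diff_divide_distrib)
next
  case (Suc d)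
  let ?x = "\<lambda>i. density (Suc k) (n * j + i)" and ?q = "real n ^ Suc k"
  let ?M = "\<lambda>i. max M (?x i)"
  have Mpos: "0 < M" using density_pos[OF Suc.prems(1)] Suc.prems(2) by simp
  have xpos: "0 < ?x i" if "i < n" for i using Suc.prems that by (intro density_pos child_index_less)
  have IH: "tree_sum n child_osc d (Suc k) (n * j + i) \<le>
      32 * real n * (max_sum n density d (Suc k) (n * j + i) (?M i) - (M - sqrt (?x i * M)) / ?q)"
    if i: "i < n" for i
  proof -
    have "M - sqrt (?x i * M) \<le> ?M i - sqrt (?x i * ?M i)"
    proof (cases "?x i \<le> M")
      case False
      then have "M * M \<le> ?x i * M" using Mpos by (intro mult_right_mono) auto
      then have "sqrt (M * M) \<le> sqrt (?x i * M)" by (rule real_sqrt_le_mono)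
      then show ?thesis using False Mpos xpos[OF i] by (simp add: max_def)
    qed (simp add: max_def)
    then have "32 * real n * (max_sum n density d (Suc k) (n * j + i) (?M i) - (?M i - sqrt (?x i * ?M i)) / ?q)
       \<le> 32 * real n * (max_sum n density d (Suc k) (n * j + i) (?M i) - (M - sqrt (?x i * M)) / ?q)"
      by (intro mult_left_mono diff_left_mono divide_right_mono) auto
    with Suc.IH[OF child_index_less[OF Suc.prems(1) i], of "?M i"] show ?thesis by simp
  qed
  have "tree_sum n child_osc (Suc d) k j
      \<le> 32 * real n / ?q * (\<Sum>i<n. sqrt (density k j * M) - sqrt (?x i * M))
       + (\<Sum>i<n. 32 * real n * (max_sum n density d (Suc k) (n * j + i) (?M i) - (M - sqrt (?x i * M)) / ?q))"
    unfolding tree_sum.simps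
    by (intro add_mono sum_mono child_osc_le Suc.prems) (use IH in auto)
  \<comment> \<open>The difference sqrt (density k j * M) - sqrt (?x i * M) cancels against the
    Bellman term of child \<open>i\<close> and leaves the term of the parent in each of the
    \<open>n\<close> summands.\<close>
  also have "\<dots> = (\<Sum>i<n. 32 * real n * (max_sum n density d (Suc k) (n * j + i) (?M i)
                       - (M - sqrt (density k j * M)) / ?q))"
    unfolding sum_distrib_left sum.distrib[symmetric]
    by (intro sum.cong refl) (simp add: field_simps)
  also have "\<dots> = 32 * real n * (max_sum n density (Suc d) k j M - real n * ((M - sqrt (density k j * M)) / ?q))"
    unfolding sum_distrib_left[symmetric] sum_subtractf by simp
  also have "real n * ((M - sqrt (density k j * M)) / ?q) = (M - sqrt (density k j * M)) / real n ^ k"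
    using n_pos by simp
  finally show ?case .
qed

text \<open>The Bellman function vanishes at the starting value M =
  \<open>density k j\<close>.\<close>

lemma tree_sum_child_osc_le:
  assumes "j < n ^ k"
  shows "tree_sum n child_osc d k j \<le> 32 * real n * max_sum n density d k j (density k j)"
  using tree_sum_child_osc_le_aux[OF assms order_refl, of d] density_pos[OF assms]
  by simp

section \<open>Carleson embedding for the dual sum\<close>

lemma sum_square_div_ge:
  fixes v u :: "nat \<Rightarrow> real"
  assumes "\<And>i. i < n \<Longrightarrow> 0 < u i"
  shows "(\<Sum>i<n. v i)\<^sup>2 / (\<Sum>i<n. u i) \<le> (\<Sum>i<n. (v i)\<^sup>2 / u i)"
proof -
  have U: "0 < (\<Sum>i<n. u i)" using n_pos assms by (intro sum_pos) auto
  have "(\<Sum>i<n. v i)\<^sup>2 = (\<Sum>i<n. (v i / sqrt (u i)) * sqrt (u i))\<^sup>2"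
    using assms by (intro arg_cong[where f="\<lambda>t. t\<^sup>2"] sum.cong) force+
  also have "\<dots> \<le> (\<Sum>i<n. (v i / sqrt (u i))\<^sup>2) * (\<Sum>i<n. (sqrt (u i))\<^sup>2)"
    by (rule Cauchy_Schwarz_ineq_sum)
  also have "\<dots> = (\<Sum>i<n. (v i)\<^sup>2 / u i) * (\<Sum>i<n. u i)"
    using assms by (simp add: power_divide less_imp_le)
  finally show ?thesis using U by (simp add: divide_le_eq)
qed

text \<open>The constant subtracted from the \<open>v i\<close> may be chosen freely because martingale differences
  have mean zero; this choice keeps the quotient bounded where a child has very small mass.\<close>

definition dual_term :: "(nat \<Rightarrow> nat \<Rightarrow> real) \<Rightarrow> nat \<Rightarrow> nat \<Rightarrow> real" where
  "dual_term v k j = (\<Sum>i<n. (v (Suc k) (n * j + i)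
      - v k j / w k j * Min ((\<lambda>i. w (Suc k) (n * j + i)) ` {..<n}))\<^sup>2 / w (Suc k) (n * j + i))"

text \<open>With h = v / w on the parent, v_i - h m = (v_i - h w_i) + h (w_i - m). The first parts
  form a weighted variance, equal to the sum of v_i^2 / w_i minus v^2 / w; the second parts give h^2
  times the oscillation.\<close>

lemma dual_term_le:
  assumes j: "j < n ^ k" and v: "v k j = (\<Sum>i<n. v (Suc k) (n * j + i))"
  shows "dual_term v k j \<le> 2 * ((\<Sum>i<n. (v (Suc k) (n * j + i))\<^sup>2 / w (Suc k) (n * j + i))
            - (v k j)\<^sup>2 / w k j) + 2 * (v k j / w k j)\<^sup>2 * child_osc k j"
proof -
  let ?w = "\<lambda>i. w (Suc k) (n * j + i)" and ?v = "\<lambda>i. v (Suc k) (n * j + i)"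
  define m where "m = Min (?w ` {..<n})"
  define h where "h = v k j / w k j"
  have wp: "0 < w k j" by (rule pos[OF j])
  have le: "(?v i - h * m)\<^sup>2 / ?w i
      \<le> 2 * ((?v i)\<^sup>2 / ?w i - 2 * h * ?v i + h\<^sup>2 * ?w i) + 2 * h\<^sup>2 * ((?w i - m)\<^sup>2 / ?w i)"
    if i: "i < n" for i
  proof -
    have p: "0 < ?w i" by (rule child_pos[OF j i])
    have "(?v i - h * m)\<^sup>2 \<le> 2 * (?v i - h * ?w i)\<^sup>2 + 2 * (h * (?w i - m))\<^sup>2"
    proof -
      have "0 \<le> ((?v i - h * ?w i) - h * (?w i - m))\<^sup>2" by simp
      then show ?thesis by (simp add: power2_eq_square algebra_simps)
    qed
    then have "(?v i - h * m)\<^sup>2 / ?w i \<le> (2 * (?v i - h * ?w i)\<^sup>2 + 2 * (h * (?w i - m))\<^sup>2) / ?w i"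
      using p by (intro divide_right_mono) auto
    also have "\<dots> = 2 * ((?v i)\<^sup>2 / ?w i - 2 * h * ?v i + h\<^sup>2 * ?w i) + 2 * h\<^sup>2 * ((?w i - m)\<^sup>2 / ?w i)"
      using p by (simp add: field_simps power2_eq_square)
    finally show ?thesis .
  qed
  have "dual_term v k j \<le> (\<Sum>i<n. 2 * ((?v i)\<^sup>2 / ?w i - 2 * h * ?v i + h\<^sup>2 * ?w i) + 2 * h\<^sup>2 * ((?w i - m)\<^sup>2 / ?w i))"
    unfolding dual_term_def m_def[symmetric] h_def[symmetric] by (intro sum_mono le) auto
  also have "\<dots> = 2 * ((\<Sum>i<n. (?v i)\<^sup>2 / ?w i) - 2 * h * v k j + h\<^sup>2 * w k j) + 2 * h\<^sup>2 * child_osc k j"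
    unfolding child_osc_def osc_def m_def[symmetric] v additive[OF j]
    by (simp add: sum.distrib sum_subtractf sum_distrib_left)
  also have "- 2 * h * v k j + h\<^sup>2 * w k j = - ((v k j)\<^sup>2 / w k j)"
    using wp by (simp add: h_def field_simps power2_eq_square)
  then have "(\<Sum>i<n. (?v i)\<^sup>2 / ?w i) - 2 * h * v k j + h\<^sup>2 * w k j = (\<Sum>i<n. (?v i)\<^sup>2 / ?w i) - (v k j)\<^sup>2 / w k j"
    by linarith
  finally show ?thesis unfolding h_def .
qed

text \<open>The Bellman function of the Carleson embedding theorem is \<open>X - v\<^sup>2 / (w + T)\<close>, where \<open>T \<le> w\<close>
  is the normalised Carleson mass below the current interval.\<close>

lemma tree_sum_dual_term_le_aux:
  assumes A: "0 < A" and carleson: "\<And>d k j. j < n ^ k \<Longrightarrow> tree_sum n child_osc d k j \<le> A * w k j"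
    and v: "\<And>k j. k < N \<Longrightarrow> j < n ^ k \<Longrightarrow> v k j = (\<Sum>i<n. v (Suc k) (n * j + i))"
    and "j < n ^ k" "k + d = N"
  shows "tree_sum n (dual_term v) d k j \<le>
     2 * (leaf_sum n (\<lambda>l. (v N l)\<^sup>2 / w N l) d j - (v k j)\<^sup>2 / w k j)
   + 8 * A * (leaf_sum n (\<lambda>l. (v N l)\<^sup>2 / w N l) d j
       - (v k j)\<^sup>2 / (w k j + tree_sum n child_osc d k j / A))"
  using assms(4,5)
proof (induction d arbitrary: k j)
  case 0
  then show ?case by simp
next
  case (Suc d)
  let ?w = "\<lambda>i. w (Suc k) (n * j + i)" and ?v = "\<lambda>i. v (Suc k) (n * j + i)"
  let ?X = "\<lambda>i. leaf_sum n (\<lambda>l. (v N l)\<^sup>2 / w N l) d (n * j + i)"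
  let ?T = "\<lambda>i. tree_sum n child_osc d (Suc k) (n * j + i) / A"
  have vk: "v k j = (\<Sum>i<n. ?v i)" using Suc.prems by (intro v) auto
  have wp: "0 < w k j" by (rule pos[OF Suc.prems(1)])
  have cwp: "0 < ?w i" if "i < n" for i by (rule child_pos[OF Suc.prems(1) that])
  have T: "0 \<le> ?T i" if "i < n" for i
    using A by (intro divide_nonneg_pos tree_sum_nonneg child_osc_nonneg child_index_less Suc.prems that)
  \<comment> \<open>\<open>U\<close> leaves out the coefficient of the current interval. Passing
    from the children to the parent thus splits into a convexity step at \<open>U\<close> and the
    addition of \<open>\<alpha>\<close>.\<close>
  define U where "U = w k j + (\<Sum>i<n. ?T i)"
  define \<alpha> where "\<alpha> = child_osc k j / A"
  have \<alpha>: "0 \<le> \<alpha>" unfolding \<alpha>_def using A child_osc_nonneg[OF Suc.prems(1)] by simp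
  have U: "0 < U" unfolding U_def using wp T by (intro add_pos_nonneg sum_nonneg) auto
  have Ua: "w k j + tree_sum n child_osc (Suc d) k j / A = U + \<alpha>"
    by (simp add: U_def \<alpha>_def add_divide_distrib sum_divide_distrib)
  have "tree_sum n child_osc (Suc d) k j / A \<le> w k j"
    using carleson[OF Suc.prems(1), of "Suc d"] A by (simp add: divide_le_eq mult.commute del: tree_sum.simps)
  then have Ule: "U + \<alpha> \<le> 2 * w k j" using Ua by simp
  have sub: "(v k j)\<^sup>2 / U \<le> (\<Sum>i<n. (?v i)\<^sup>2 / (?w i + ?T i))"
  proof -
    have "U = (\<Sum>i<n. ?w i + ?T i)" unfolding U_def additive[OF Suc.prems(1)] by (simp add: sum.distrib)
    then show ?thesis unfolding vk
      by (simp only:) (intro sum_square_div_ge, use cwp T in \<open>simp add: add_pos_nonneg\<close>)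
  qed
  \<comment> \<open>By the Carleson condition U + \<alpha> <= 2 w, so adding \<alpha> lowers v^2 / U
    by at least a quarter of (v / w)^2 \<alpha>. Together with the 2 in \<open>dual_term_le\<close>
    this produces the factor 8 A.\<close>
  have mass_gain: "(v k j / w k j)\<^sup>2 * \<alpha> \<le> 4 * ((v k j)\<^sup>2 / U - (v k j)\<^sup>2 / (U + \<alpha>))"
  proof -
    have "U * (U + \<alpha>) \<le> (2 * w k j) * (2 * w k j)" using Ule U \<alpha> by (intro mult_mono) auto
    then have "\<alpha> / (4 * (w k j)\<^sup>2) \<le> \<alpha> / (U * (U + \<alpha>))"
      using U \<alpha> wp by (intro divide_left_mono) (auto simp: power2_eq_square add_pos_nonneg)
    also have "\<dots> = 1 / U - 1 / (U + \<alpha>)" using U \<alpha> by (simp add: field_simps add_pos_nonneg)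
    finally have "4 * (v k j)\<^sup>2 * (\<alpha> / (4 * (w k j)\<^sup>2)) \<le> 4 * (v k j)\<^sup>2 * (1 / U - 1 / (U + \<alpha>))"
      by (intro mult_left_mono) auto
    then show ?thesis by (simp add: power_divide algebra_simps)
  qed
  have "tree_sum n (dual_term v) (Suc d) k j
     \<le> (2 * ((\<Sum>i<n. (?v i)\<^sup>2 / ?w i) - (v k j)\<^sup>2 / w k j) + 2 * (v k j / w k j)\<^sup>2 * child_osc k j)
      + (\<Sum>i<n. 2 * (?X i - (?v i)\<^sup>2 / ?w i) + 8 * A * (?X i - (?v i)\<^sup>2 / (?w i + ?T i)))"
    unfolding tree_sum.simps
    by (intro add_mono sum_mono dual_term_le Suc.IH child_index_less vk) (use Suc.prems in auto)
  also have "\<dots> = 2 * ((\<Sum>i<n. ?X i) - (v k j)\<^sup>2 / w k j) + 2 * A * ((v k j / w k j)\<^sup>2 * \<alpha>)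
      + 8 * A * ((\<Sum>i<n. ?X i) - (\<Sum>i<n. (?v i)\<^sup>2 / (?w i + ?T i)))"
    using A by (simp only: sum.distrib sum_subtractf right_diff_distrib flip: sum_distrib_left)
      (simp add: \<alpha>_def algebra_simps)
  also have "\<dots> \<le> 2 * ((\<Sum>i<n. ?X i) - (v k j)\<^sup>2 / w k j)
      + 2 * A * (4 * ((v k j)\<^sup>2 / U - (v k j)\<^sup>2 / (U + \<alpha>)))
      + 8 * A * ((\<Sum>i<n. ?X i) - (v k j)\<^sup>2 / U)"
    using A by (intro add_mono mult_left_mono diff_left_mono mass_gain sub order_refl) auto
  also have "\<dots> = 2 * ((\<Sum>i<n. ?X i) - (v k j)\<^sup>2 / w k j) + 8 * A * ((\<Sum>i<n. ?X i) - (v k j)\<^sup>2 / (U + \<alpha>))"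
    by (simp add: algebra_simps)
  finally show ?case unfolding Ua by simp
qed

lemma tree_sum_dual_term_le:
  assumes A: "0 < A" and carleson: "\<And>d k j. j < n ^ k \<Longrightarrow> tree_sum n child_osc d k j \<le> A * w k j"
    and v: "\<And>k j. k < N \<Longrightarrow> j < n ^ k \<Longrightarrow> v k j = (\<Sum>i<n. v (Suc k) (n * j + i))"
  shows "(\<Sum>k<N. \<Sum>j<n ^ k. dual_term v k j) \<le> (2 + 8 * A) * (\<Sum>l<n ^ N. (v N l)\<^sup>2 / w N l)"
proof -
  have w0: "0 < w 0 0" by (rule pos) simp
  have T: "0 \<le> tree_sum n child_osc N 0 0 / A"
    using A by (intro divide_nonneg_pos tree_sum_nonneg child_osc_nonneg) auto
  let ?X = "leaf_sum n (\<lambda>l. (v N l)\<^sup>2 / w N l) N 0"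
  have "tree_sum n (dual_term v) N 0 0 \<le> 2 * (?X - (v 0 0)\<^sup>2 / w 0 0)
      + 8 * A * (?X - (v 0 0)\<^sup>2 / (w 0 0 + tree_sum n child_osc N 0 0 / A))"
    by (rule tree_sum_dual_term_le_aux[where N = N and v = v, OF A carleson v]) auto
  \<comment> \<open>The quotients subtracted at the root are nonnegative and are dropped.\<close>
  also have "\<dots> \<le> 2 * ?X + 8 * A * ?X"
    using A w0 T by (intro add_mono mult_left_mono) (auto simp: divide_nonneg_pos)
  finally show ?thesis by (simp add: tree_sum_root leaf_sum_root algebra_simps)
qed

text \<open>Cauchy-Schwarz takes the form of Young's inequality with parameter \<open>L\<close>, so
  that half of the left side, a finite real sum, can be absorbed.\<close>

lemma square_function_lower_bound:
  assumes A: "0 < A" and carleson: "\<And>d k j. j < n ^ k \<Longrightarrow> tree_sum n child_osc d k j \<le> A * w k j"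
    and F: "\<And>k j. j < n ^ k \<Longrightarrow> (\<Sum>i<n. F (Suc k) (n * j + i)) = real n * F k j"
    and F0: "F 0 0 = 0"
  shows "(\<Sum>l<n ^ N. (F N l)\<^sup>2 * w N l) \<le> (2 + 8 * A) *
     (\<Sum>k<N. \<Sum>j<n ^ k. \<Sum>i<n. (F (Suc k) (n * j + i) - F k j)\<^sup>2 * w (Suc k) (n * j + i))"
proof -
  \<comment> \<open>In the application \<open>v k j\<close> is the integral of f_N w over the
    interval (k, j); it is additive for k < N.\<close>
  define v where "v k j = leaf_sum n (\<lambda>l. F N l * w N l) (N - k) j" for k j
  have vN: "v N l = F N l * w N l" for l by (simp add: v_def)
  have v: "v k j = (\<Sum>i<n. v (Suc k) (n * j + i))" if "k < N" for k j
  proof -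
    have "N - k = Suc (N - Suc k)" using that by simp
    then show ?thesis by (simp add: v_def)
  qed
  define L where "L = 2 + 8 * A"
  have L: "0 < L" using A by (simp add: L_def)
  define X where "X = (\<Sum>l<n ^ N. (F N l)\<^sup>2 * w N l)"
  let ?d = "\<lambda>k j i. F (Suc k) (n * j + i) - F k j"
  let ?S = "\<Sum>k<N. \<Sum>j<n ^ k. \<Sum>i<n. (?d k j i)\<^sup>2 * w (Suc k) (n * j + i)"
  have Xv: "(\<Sum>l<n ^ N. (v N l)\<^sup>2 / w N l) = X"
    unfolding X_def vN by (intro sum.cong refl) (use pos in \<open>force simp: power2_eq_square\<close>)
  \<comment> \<open>For k <= N, \<open>Y k\<close> represents the integral of f_k f_N w. It starts
    at 0 because the mean of f is 0, and ends at \<open>X\<close>.\<close>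
  define Y where "Y k = (\<Sum>j<n ^ k. F k j * v k j)" for k
  have Ystep: "Y (Suc k) - Y k = (\<Sum>j<n ^ k. \<Sum>i<n. ?d k j i * v (Suc k) (n * j + i))" if "k < N" for k
    unfolding Y_def sum_lessThan_power_Suc v[OF that]
    by (simp add: sum_distrib_left sum_subtractf left_diff_distrib)
  have term_le: "(\<Sum>i<n. ?d k j i * v (Suc k) (n * j + i))
      \<le> L / 2 * (\<Sum>i<n. (?d k j i)\<^sup>2 * w (Suc k) (n * j + i)) + 1 / (2 * L) * dual_term v k j"
    if j: "j < n ^ k" for k j
  proof -
    define c where "c = v k j / w k j * Min ((\<lambda>i. w (Suc k) (n * j + i)) ` {..<n})"
    have "(\<Sum>i<n. ?d k j i) = 0" by (simp add: sum_subtractf F[OF j])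
    then have "(\<Sum>i<n. ?d k j i * v (Suc k) (n * j + i)) = (\<Sum>i<n. ?d k j i * (v (Suc k) (n * j + i) - c))"
      by (simp add: right_diff_distrib sum_subtractf flip: sum_distrib_right)
    also have "\<dots> \<le> (\<Sum>i<n. L / 2 * ((?d k j i)\<^sup>2 * w (Suc k) (n * j + i))
         + 1 / (2 * L) * ((v (Suc k) (n * j + i) - c)\<^sup>2 / w (Suc k) (n * j + i)))"
    proof (rule sum_mono)
      fix i assume "i \<in> {..<n}"
      then have p: "0 < w (Suc k) (n * j + i)" (is "0 < ?p") using child_pos[OF j] by simp
      define D E where "D = ?d k j i" and "E = v (Suc k) (n * j + i) - c"
      \<comment> \<open>Nonnegativity of this square is D E <= (L / 2) D^2 p + E^2 / (2 L
        p).\<close>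
      have "0 \<le> (L * ?p * D - E)\<^sup>2 / (2 * L * ?p)" using L p by simp
      also have "\<dots> = L / 2 * (D\<^sup>2 * ?p) + 1 / (2 * L) * (E\<^sup>2 / ?p) - D * E"
        using L p by (simp add: field_simps power2_eq_square)
      finally show "?d k j i * (v (Suc k) (n * j + i) - c) \<le> L / 2 * ((?d k j i)\<^sup>2 * w (Suc k) (n * j + i))
         + 1 / (2 * L) * ((v (Suc k) (n * j + i) - c)\<^sup>2 / w (Suc k) (n * j + i))"
        unfolding D_def E_def by simp
    qed
    finally show ?thesis
      by (simp only: dual_term_def c_def[symmetric] sum.distrib sum_distrib_left)
  qed
  have "X = Y N - Y 0"
    using F0 by (simp add: X_def Y_def vN power2_eq_square mult.assoc)
  also have "\<dots> = (\<Sum>k<N. Y (Suc k) - Y k)" by (simp add: sum_lessThan_telescope)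
  also have "\<dots> = (\<Sum>k<N. \<Sum>j<n ^ k. \<Sum>i<n. ?d k j i * v (Suc k) (n * j + i))"
    by (intro sum.cong refl Ystep) auto
  also have "\<dots> \<le> (\<Sum>k<N. \<Sum>j<n ^ k. L / 2 * (\<Sum>i<n. (?d k j i)\<^sup>2 * w (Suc k) (n * j + i))
        + 1 / (2 * L) * dual_term v k j)"
    by (intro sum_mono term_le) auto
  also have "\<dots> = L / 2 * ?S + 1 / (2 * L) * (\<Sum>k<N. \<Sum>j<n ^ k. dual_term v k j)"
    by (simp only: sum.distrib sum_distrib_left)
  \<comment> \<open>The dual sum is at most L X, so the weight 1 / (2 L) leaves X / 2 for
    absorption.\<close>
  also have "\<dots> \<le> L / 2 * ?S + 1 / (2 * L) * (L * X)"
    using tree_sum_dual_term_le[where N = N and v = v, OF A carleson v] L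
    by (intro add_left_mono mult_left_mono) (auto simp: Xv L_def)
  also have "\<dots> = L / 2 * ?S + X / 2" using L by simp
  finally have "X \<le> L * ?S" by simp
  then show ?thesis unfolding X_def L_def .
qed

end

section \<open>Square roots, differentiation of averages, \<open>n\<close>-adic intervals\<close>

lemma esqrt_power2: "(esqrt x)\<^sup>2 = x"
  by (cases x) (auto simp: esqrt_def ennreal_power ennreal_top_mult power2_eq_square simp flip: ennreal_mult)

lemma esqrt_mono: "x \<le> y \<Longrightarrow> esqrt x \<le> esqrt y"
  by (cases x; cases y) (auto simp: esqrt_def ennreal_le_iff top_unique intro!: ennreal_leI)

text \<open>The mixed cases agree because 0 * top = 0 on both sides.\<close>

lemma esqrt_mult: "esqrt (x * y) = esqrt x * esqrt y"
proof (cases x; cases y)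
  fix a b assume "0 \<le> a" "x = ennreal a" "0 \<le> b" "y = ennreal b"
  then show ?thesis by (simp add: esqrt_def real_sqrt_mult flip: ennreal_mult)
next
  fix a assume "0 \<le> a" "x = ennreal a" "y = top"
  then show ?thesis by (cases "a = 0") (auto simp: esqrt_def ennreal_mult_top)
next
  fix b assume "0 \<le> b" "y = ennreal b" "x = top"
  then show ?thesis by (cases "b = 0") (auto simp: esqrt_def ennreal_top_mult)
qed (auto simp: esqrt_def)

lemma esqrt_ennreal_power2: "0 \<le> c \<Longrightarrow> esqrt (ennreal (c\<^sup>2)) = ennreal c"
  by (simp add: esqrt_def)

text \<open>Differentiation over intervals with left endpoint x, applied to \<open>f\<close> and to
  its reflection, gives both one-sided statements; an interval containing x is cut at x. The form
  multiplied by the length also covers degenerate pieces.\<close>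

lemma AE_averages_converge:
  fixes f :: "real \<Rightarrow> real"
  assumes "\<And>a b. f integrable_on {a..b}"
  shows "AE x in lborel. \<forall>e>0. \<exists>d>0. \<forall>a b. a \<le> x \<and> x \<le> b \<and> b - a < d \<longrightarrow>
           \<bar>integral {a..b} f - (b - a) * f x\<bar> \<le> e * (b - a)"
proof -
  define g where "g x = f (- x)" for x
  have g: "g integrable_on {a..b}" for a b
    using assms[of "- b" "- a"] Henstock_Kurzweil_Integration.integrable_reflect_real[where f = f and a = "- b" and b = "- a"] by (simp add: g_def[abs_def])
  obtain N1 where N1: "negligible N1" and f1: "\<And>x e. \<lbrakk>x \<notin> N1; 0 < e\<rbrakk> \<Longrightarrow>
      \<exists>d>0. \<forall>h. 0 < h \<and> h < d \<longrightarrow> norm (integral (cbox x (x + h *\<^sub>R One)) f /\<^sub>R h ^ DIM(real) - f x) < e"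
    using integrable_ccontinuous_explicit[of f] assms by (metis box_real(2))
  obtain N2 where N2: "negligible N2" and g1: "\<And>x e. \<lbrakk>x \<notin> N2; 0 < e\<rbrakk> \<Longrightarrow>
      \<exists>d>0. \<forall>h. 0 < h \<and> h < d \<longrightarrow> norm (integral (cbox x (x + h *\<^sub>R One)) g /\<^sub>R h ^ DIM(real) - g x) < e"
    using integrable_ccontinuous_explicit[of g] g by (metis box_real(2))
  have "negligible (uminus ` N2)"
    by (intro negligible_differentiable_image_negligible N2) (auto intro: differentiable_on_minus differentiable_on_id)
  then have "N1 \<union> uminus ` N2 \<in> null_sets lebesgue"
    using N1 by (simp flip: negligible_iff_null_sets)
  then have "AE x in lebesgue. x \<notin> N1 \<union> uminus ` N2" by (rule AE_not_in)
  then have "AE x in lborel. x \<notin> N1 \<union> uminus ` N2" by (simp add: AE_completion_iff)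
  then show ?thesis
  proof (rule AE_mp, intro AE_I2 impI allI)
    fix x e :: real assume x: "x \<notin> N1 \<union> uminus ` N2" and e: "0 < e"
    have *: "\<bar>I - h * c\<bar> \<le> e * h" if "0 < h" "\<bar>I / h - c\<bar> < e" for h I c :: real
    proof -
      have "\<bar>I - h * c\<bar> = h * \<bar>I / h - c\<bar>"
        using that(1) by (simp add: abs_mult_pos' right_diff_distrib)
      also have "\<dots> \<le> h * e" using that by (intro mult_left_mono) auto
      finally show ?thesis by (simp add: mult.commute)
    qed
    obtain d1 where d1: "0 < d1" "\<And>h. 0 < h \<Longrightarrow> h < d1 \<Longrightarrow> \<bar>integral {x..x + h} f / h - f x\<bar> < e"
      using f1[of x e] x e by (auto simp: divide_inverse mult.commute)
    have "- x \<notin> N2" using x by force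
    then obtain d2 where d2: "0 < d2" "\<And>h. 0 < h \<Longrightarrow> h < d2 \<Longrightarrow> \<bar>integral {- x..- x + h} g / h - g (- x)\<bar> < e"
      using g1[of "- x" e] e by (auto simp: divide_inverse mult.commute)
    show "\<exists>d>0. \<forall>a b. a \<le> x \<and> x \<le> b \<and> b - a < d \<longrightarrow>
           \<bar>integral {a..b} f - (b - a) * f x\<bar> \<le> e * (b - a)"
    proof (intro exI[of _ "min d1 d2"] conjI allI impI)
      fix a b assume ab: "a \<le> x \<and> x \<le> b \<and> b - a < min d1 d2"
      have R: "\<bar>integral {x..b} f - (b - x) * f x\<bar> \<le> e * (b - x)"
      proof (cases "b = x")
        case False
        then show ?thesis using d1(2)[of "b - x"] ab by (intro *) auto
      qed simp
      have L: "\<bar>integral {a..x} f - (x - a) * f x\<bar> \<le> e * (x - a)"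
      proof (cases "a = x")
        case False
        have "integral {- x..- a} g = integral {a..x} f"
          using integral_reflect_real[where f = f and a = a and b = x] by (simp add: g_def[abs_def])
        then show ?thesis using False d2(2)[of "x - a"] ab by (intro *) (auto simp: g_def)
      qed simp
      have "integral {a..b} f = integral {a..x} f + integral {x..b} f"
        using ab assms by (simp add: Henstock_Kurzweil_Integration.integral_combine)
      then have "\<bar>integral {a..b} f - (b - a) * f x\<bar>
          = \<bar>(integral {a..x} f - (x - a) * f x) + (integral {x..b} f - (b - x) * f x)\<bar>"
        by (simp add: algebra_simps)
      also have "\<dots> \<le> e * (x - a) + e * (b - x)" using L R by linarith
      finally show "\<bar>integral {a..b} f - (b - a) * f x\<bar> \<le> e * (b - a)" by (simp add: algebra_simps)
    qed (use d1 d2 in auto)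
  qed
qed

section \<open>Arithmetic of n-adic intervals\<close>

lemma mem_nadic_iff: "0 < n \<Longrightarrow> x \<in> nadic n k j \<longleftrightarrow> \<lfloor>x * real n ^ k\<rfloor> = int j"
  by (auto simp: nadic_def floor_eq_iff pos_divide_le_eq pos_less_divide_eq)

lemma sets_nadic [measurable, simp]: "nadic n k j \<in> sets borel"
  by (simp add: nadic_def)

lemma measure_nadic: "0 < n \<Longrightarrow> measure lborel (nadic n k j) = 1 / real n ^ k"
  by (simp add: nadic_def divide_right_mono flip: diff_divide_distrib)

lemma emeasure_nadic: "0 < n \<Longrightarrow> emeasure lborel (nadic n k j) = ennreal (1 / real n ^ k)"
  by (simp add: nadic_def divide_right_mono flip: diff_divide_distrib)

lemma disjoint_nadic: "0 < n \<Longrightarrow> disjoint_family_on (nadic n k) J"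
  by (auto simp: disjoint_family_on_def mem_nadic_iff)

lemma nadic_subset:
  assumes "j < n ^ k" shows "nadic n k j \<subseteq> {0..<1}"
proof -
  have n: "0 < real n ^ k" using assms by (metis of_nat_0_less_iff of_nat_power gr_zeroI less_nat_zero_code)
  have "real (Suc j) \<le> real (n ^ k)" using assms by (intro of_nat_mono) simp
  then show ?thesis using n by (auto simp: nadic_def field_simps intro: order.trans dual_order.trans)
qed

text \<open>In terms of floors, floor (x n^k) is floor (x n^(k+1)) div n, and the remainder is the
  position of the child.\<close>

lemma nadic_children:
  assumes "0 < n" shows "nadic n k j = (\<Union>i<n. nadic n (Suc k) (n * j + i))"
proof (intro set_eqI)
  fix x
  let ?m = "\<lfloor>x * real n ^ Suc k\<rfloor>"
  have "\<lfloor>x * real n ^ k\<rfloor> = \<lfloor>x * real n ^ Suc k / real_of_int (int n)\<rfloor>" using assms by simp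
  also have "\<dots> = ?m div int n" by (rule floor_divide_real_eq_div) simp
  finally have eq: "\<lfloor>x * real n ^ k\<rfloor> = ?m div int n" .
  have "?m div int n = int j \<longleftrightarrow> (\<exists>i<n. ?m = int (n * j + i))"
  proof
    assume "?m div int n = int j"
    then have "?m = int (n * j + nat (?m mod int n))"
      using assms div_mult_mod_eq[of ?m "int n"] by (simp add: mult.commute)
    moreover have "nat (?m mod int n) < n" using assms by (simp add: nat_less_iff)
    ultimately show "\<exists>i<n. ?m = int (n * j + i)" by blast
  next
    assume "\<exists>i<n. ?m = int (n * j + i)"
    then obtain i where "i < n" "?m = int (n * j + i)" by blast
    then show "?m div int n = int j" by (simp only: flip: of_nat_div) simp
  qed
  then show "x \<in> nadic n k j \<longleftrightarrow> x \<in> (\<Union>i<n. nadic n (Suc k) (n * j + i))"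
    using assms by (simp add: mem_nadic_iff eq Bex_def del: power_Suc)
qed

lemma disjoint_nadic_children: "0 < n \<Longrightarrow> disjoint_family_on (\<lambda>i. nadic n (Suc k) (n * j + i)) J"
  by (auto simp: disjoint_family_on_def mem_nadic_iff)

lemma nadic_cover:
  assumes n: "0 < n" and x: "0 \<le> x" "x < 1" obtains j where "j < n ^ k" "x \<in> nadic n k j"
proof
  have p: "0 < real n ^ k" using n by simp
  have "x * real n ^ k < real n ^ k" using x p by simp
  then show "nat \<lfloor>x * real n ^ k\<rfloor> < n ^ k"
    using x by (simp add: nat_less_iff floor_less_iff)
  show "x \<in> nadic n k (nat \<lfloor>x * real n ^ k\<rfloor>)" using x n by (simp add: mem_nadic_iff)
qed

lemma sum_indicator_eq:
  fixes c :: "'i \<Rightarrow> real"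
  assumes "disjoint_family_on A J" "finite J" "l \<in> J" "x \<in> A l"
  shows "(\<Sum>j\<in>J. c j * indicator (A j) x) = c l"
proof -
  have "(\<Sum>j\<in>J. c j * indicator (A j) x) = (\<Sum>j\<in>J. if j = l then c l else 0)"
    using assms by (intro sum.cong refl) (auto simp: disjoint_family_on_def indicator_def)
  then show ?thesis using assms by simp
qed

lemma sum_indicator_power2:
  fixes c :: "'i \<Rightarrow> real"
  assumes "disjoint_family_on A J" "finite J"
  shows "(\<Sum>j\<in>J. c j * indicator (A j) x)\<^sup>2 = (\<Sum>j\<in>J. (c j)\<^sup>2 * indicator (A j) x)"
proof (cases "\<exists>l\<in>J. x \<in> A l")
  case True
  then obtain l where "l \<in> J" "x \<in> A l" by blast
  then show ?thesis using assms by (simp only: sum_indicator_eq)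
next
  case False
  then have "(\<Sum>j\<in>J. c j * indicator (A j) x) = 0" "(\<Sum>j\<in>J. (c j)\<^sup>2 * indicator (A j) x) = 0"
    by (auto intro!: sum.neutral simp: indicator_def)
  then show ?thesis by simp
qed

section \<open>Convergence of n-adic conditional expectations\<close>

definition nadic_expectation :: "nat \<Rightarrow> nat \<Rightarrow> (real \<Rightarrow> real) \<Rightarrow> real \<Rightarrow> real" where
  "nadic_expectation n k f x = (\<Sum>j<n ^ k. avg f (nadic n k j) * indicator (nadic n k j) x)"

text \<open>The n-adic intervals around x shrink to x without being centred there or having x as an
  endpoint, hence the appeal to differentiation over all intervals containing x.\<close>

lemma nadic_expectation_tendsto:
  assumes n: "2 \<le> n" and f: "set_integrable lborel {0..1} f"
  shows "AE x in lborel. x \<in> {0..1} \<longrightarrow> (\<lambda>k. nadic_expectation n k f x) \<longlonglongrightarrow> f x"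
proof -
  \<comment> \<open>The cutoff is integrable on every compact interval of the line.\<close>
  define g where "g x = indicator {0..1} x * f x" for x
  have g: "integrable lborel g" using f by (simp add: set_integrable_def g_def[abs_def])
  have gS: "set_integrable lborel S g" if "S \<in> sets borel" for S
    using g that unfolding set_integrable_def by (intro integrable_mult_indicator) auto
  have "g integrable_on {a..b}" for a b
    using gS[of "{a..b}"] by (intro set_borel_integral_eq_integral) auto
  note AE_averages_converge[OF this]
  \<comment> \<open>The point 1 lies in none of the half-open intervals, so the expectation is 0
    there.\<close>
  moreover have "AE x in lborel. x \<noteq> (1::real)" by (rule AE_lborel_singleton)
  ultimately show ?thesis
  proof (eventually_elim, intro impI)
    fix x :: real
    assume conv: "\<forall>e>0. \<exists>d>0. \<forall>a b. a \<le> x \<and> x \<le> b \<and> b - a < d \<longrightarrow>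
           \<bar>integral {a..b} g - (b - a) * g x\<bar> \<le> e * (b - a)"
      and "x \<noteq> 1" and "x \<in> {0..1}"
    then have x: "0 \<le> x" "x < 1" by auto
    show "(\<lambda>k. nadic_expectation n k f x) \<longlonglongrightarrow> f x"
    proof (rule LIMSEQ_I)
      fix r :: real assume r: "0 < r"
      then obtain d where d: "0 < d" and conv: "\<And>a b. a \<le> x \<Longrightarrow> x \<le> b \<Longrightarrow> b - a < d \<Longrightarrow>
           \<bar>integral {a..b} g - (b - a) * g x\<bar> \<le> r / 2 * (b - a)"
        using conv[rule_format, of "r / 2"] by auto
      have "(\<lambda>k. (1 / real n) ^ k) \<longlonglongrightarrow> 0" using n by (intro LIMSEQ_power_zero) auto
      then obtain K where K: "\<And>k. K \<le> k \<Longrightarrow> (1 / real n) ^ k < d"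
        using d by (metis (no_types, lifting) order_tendstoD(2) eventually_sequentially)
      show "\<exists>K. \<forall>k\<ge>K. norm (nadic_expectation n k f x - f x) < r"
      proof (intro exI[of _ K] allI impI)
        fix k assume k: "K \<le> k"
        obtain j where j: "j < n ^ k" "x \<in> nadic n k j" using nadic_cover[of n x k] n x by auto
        define a b where "a = real j / real n ^ k" and "b = (real j + 1) / real n ^ k"
        have I: "nadic n k j = {a..<b}" by (simp add: nadic_def a_def b_def)
        have ba: "b - a = 1 / real n ^ k" by (simp add: a_def b_def flip: diff_divide_distrib)
        then have ba0: "0 < b - a" using n by simp
        have bad: "b - a < d" using K[OF k] ba by (simp add: power_one_over)
        \<comment> \<open>The average passes to the closed interval, at the cost of a null endpoint,
          and from the Lebesgue to the gauge integral.\<close>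
        have "(LINT x:{a..<b}|lborel. f x) = (LINT x:{a..<b}|lborel. g x)"
          using nadic_subset[OF j(1)] unfolding I
          by (intro set_lebesgue_integral_cong) (auto simp: g_def indicator_def subset_iff)
        also have "\<dots> = (LINT x:{a..b}|lborel. g x)"
        proof (rule set_integral_null_delta)
          show "sym_diff {a..<b} {a..b} \<in> null_sets lborel"
          proof (rule null_sets_subset)
            show "{b} \<in> null_sets lborel" by auto
          qed (use ba0 in auto)
        qed (use g gS in auto)
        also have "\<dots> = integral {a..b} g" by (intro set_borel_integral_eq_integral gS) auto
        finally have "avg f (nadic n k j) = integral {a..b} g / (b - a)"
          using ba0 by (simp add: avg_def I)
        moreover have "nadic_expectation n k f x = avg f (nadic n k j)"
          unfolding nadic_expectation_def using j n by (intro sum_indicator_eq disjoint_nadic) auto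
        moreover have "\<bar>integral {a..b} g - (b - a) * g x\<bar> \<le> r / 2 * (b - a)"
          using j(2) bad unfolding I by (intro conv) auto
        moreover have "\<bar>integral {a..b} g / (b - a) - g x\<bar> = \<bar>integral {a..b} g - (b - a) * g x\<bar> / (b - a)"
        proof -
          have "integral {a..b} g / (b - a) - g x = (integral {a..b} g - (b - a) * g x) / (b - a)"
            using ba0 by (simp only: diff_divide_distrib) simp
          then show ?thesis using ba0 by (simp only: abs_divide abs_of_pos)
        qed
        ultimately have "\<bar>nadic_expectation n k f x - g x\<bar> \<le> r / 2"
          using ba0 by (simp add: divide_le_eq)
        moreover have "g x = f x" using x by (simp add: g_def)
        ultimately show "norm (nadic_expectation n k f x - f x) < r" using r by simp
      qed
    qed
  qed
qed

section \<open>The weighted estimate\<close>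

lemma ennreal_divide_mult_cancel: "0 < c \<Longrightarrow> x / ennreal c * ennreal c = x"
  by (simp add: ennreal_divide_times ennreal_divide_self)

locale nadic_weight =
  fixes n :: nat and w :: "real \<Rightarrow> real"
  assumes n2: "2 \<le> n"
    and w_meas [measurable]: "w \<in> borel_measurable borel"
    and w_int: "set_integrable lborel {0..1} w"
    and w_pos: "AE x in lborel. x \<in> {0..1} \<longrightarrow> 0 < w x"
begin

definition mass :: "nat \<Rightarrow> nat \<Rightarrow> real" where
  "mass k j = (LINT x:nadic n k j|lborel. w x)"

lemma n0: "0 < n" using n2 by simp

lemma nadic_unit: "j < n ^ k \<Longrightarrow> nadic n k j \<subseteq> {0..1}"
  using nadic_subset[of j n k] by force

lemma set_integrable_nadic:
  fixes f :: "real \<Rightarrow> real"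
  shows "set_integrable lborel {0..1} f \<Longrightarrow> j < n ^ k \<Longrightarrow> set_integrable lborel (nadic n k j) f"
  by (rule set_integrable_subset) (auto dest: nadic_unit)

lemma set_integral_children:
  fixes f :: "real \<Rightarrow> real"
  assumes "set_integrable lborel {0..1} f" "j < n ^ k"
  shows "(LINT x:nadic n k j|lborel. f x) = (\<Sum>i<n. LINT x:nadic n (Suc k) (n * j + i)|lborel. f x)"
  unfolding nadic_children[OF n0, of k j] using assms n0
  by (intro set_integral_finite_Union disjoint_nadic_children set_integrable_nadic child_index_less) auto

lemma nn_integral_nadic:
  assumes "j < n ^ k"
  shows "(\<integral>\<^sup>+x\<in>nadic n k j. ennreal (w x) \<partial>lborel) = ennreal (mass k j)"
proof -
  have ae: "AE x in lborel. 0 \<le> indicator (nadic n k j) x * w x"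
    using w_pos by eventually_elim (use nadic_unit[OF assms] in \<open>auto simp: indicator_def\<close>)
  have "(\<integral>\<^sup>+x\<in>nadic n k j. ennreal (w x) \<partial>lborel) = (\<integral>\<^sup>+x. ennreal (indicator (nadic n k j) x * w x) \<partial>lborel)"
    by (intro nn_integral_cong) (auto simp: indicator_def)
  also have "\<dots> = ennreal (mass k j)"
    unfolding mass_def set_lebesgue_integral_def using set_integrable_nadic[OF w_int assms] ae
    by (subst nn_integral_eq_integral) (auto simp: set_integrable_def)
  finally show ?thesis .
qed

text \<open>A vanishing integral would force w = 0 almost everywhere on an interval of positive
  length.\<close>

lemma mass_pos:
  assumes "j < n ^ k" shows "0 < mass k j"
proof (rule ccontr)
  assume "\<not> 0 < mass k j"
  then have "(\<integral>\<^sup>+x\<in>nadic n k j. ennreal (w x) \<partial>lborel) = 0"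
    using nn_integral_nadic[OF assms] by (simp add: ennreal_neg)
  then have "AE x in lborel. ennreal (w x) * indicator (nadic n k j) x = 0"
    by (subst (asm) nn_integral_0_iff_AE) auto
  with w_pos have "AE x in lborel. x \<notin> nadic n k j"
    by eventually_elim (use nadic_unit[OF assms] in \<open>auto simp: indicator_def split: if_splits\<close>)
  then have "emeasure lborel (nadic n k j) = 0"
    by (subst (asm) AE_iff_measurable[OF _ refl]) auto
  then show False using n0 by (simp add: emeasure_nadic)
qed

sublocale mass_tree n mass
proof
  show "mass k j = (\<Sum>i<n. mass (Suc k) (n * j + i))" if "j < n ^ k" for k j
    unfolding mass_def by (rule set_integral_children[OF w_int that])
qed (use n0 mass_pos in auto)

lemma density_eq_avg: "density k j = avg w (nadic n k j)"
  using n0 by (simp add: density_def avg_def mass_def measure_nadic)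

section \<open>Truncated maximal functions and the characteristic\<close>

lemma density_le_loc_max:
  assumes "j < n ^ k" "nadic n k j \<subseteq> I" "x \<in> nadic n k j"
  shows "ennreal (density k j) \<le> loc_max I w x"
proof -
  have "ennreal \<bar>avg w (nadic n k j)\<bar> \<le>
      (SUP J\<in>{J. \<exists>a b. a < b \<and> (J = {a..b} \<or> J = {a<..<b} \<or> J = {a..<b} \<or> J = {a<..b})
                    \<and> J \<subseteq> I \<and> x \<in> J}. ennreal \<bar>avg w J\<bar>)"
  proof (rule SUP_upper, rule CollectI)
    have "real j / real n ^ k < (real j + 1) / real n ^ k"
      using n0 by (intro divide_strict_right_mono) auto
    then show "\<exists>a b. a < b \<and> (nadic n k j = {a..b} \<or> nadic n k j = {a<..<b}
        \<or> nadic n k j = {a..<b} \<or> nadic n k j = {a<..b}) \<and> nadic n k j \<subseteq> I \<and> x \<in> nadic n k j"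
      using assms(2,3) nadic_def[of n k j] by blast
  qed
  moreover have "x \<in> I" using assms by blast
  ultimately show ?thesis
    using density_pos[OF assms(1)] by (simp add: loc_max_def density_eq_avg)
qed

text \<open>The integral of the maximal function is bounded from below through measurable minorants
  because \<open>nn_integral\<close> is additive only on measurable functions.\<close>

lemma max_sum_minorant:
  assumes "j < n ^ k" "nadic n k j \<subseteq> I" "0 \<le> M" "\<And>x. x \<in> nadic n k j \<Longrightarrow> ennreal M \<le> loc_max I w x"
  shows "\<exists>g\<in>borel_measurable borel. (\<forall>x. g x \<le> loc_max I w x * indicator (nadic n k j) x)
     \<and> (\<integral>\<^sup>+x. g x \<partial>lborel) = ennreal (max_sum n density d k j M) \<and> 0 \<le> max_sum n density d k j M"
  using assms
proof (induction d arbitrary: k j M)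
  case 0
  show ?case
  proof (intro bexI[of _ "\<lambda>x. ennreal M * indicator (nadic n k j) x"] conjI allI)
    show "(\<integral>\<^sup>+x. ennreal M * indicator (nadic n k j) x \<partial>lborel) = ennreal (max_sum n density 0 k j M)"
      using 0 n0 by (simp add: nn_integral_cmult_indicator emeasure_nadic flip: ennreal_mult)
  qed (use 0 in \<open>auto simp: indicator_def\<close>)
next
  case (Suc d)
  let ?J = "\<lambda>i. nadic n (Suc k) (n * j + i)" and ?x = "\<lambda>i. density (Suc k) (n * j + i)"
  have sub: "?J i \<subseteq> nadic n k j" if "i < n" for i
    using that unfolding nadic_children[OF n0, of k j] by blast
  have "\<exists>g\<in>borel_measurable borel. (\<forall>x. g x \<le> loc_max I w x * indicator (?J i) x)
     \<and> (\<integral>\<^sup>+x. g x \<partial>lborel) = ennreal (max_sum n density d (Suc k) (n * j + i) (max M (?x i)))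
     \<and> 0 \<le> max_sum n density d (Suc k) (n * j + i) (max M (?x i))" if i: "i < n" for i
  proof (rule Suc.IH)
    show "n * j + i < n ^ Suc k" by (rule child_index_less[OF Suc.prems(1) i])
    show "?J i \<subseteq> I" using sub[OF i] Suc.prems(2) by blast
    fix x assume "x \<in> ?J i"
    then show "ennreal (max M (?x i)) \<le> loc_max I w x"
      using Suc.prems(4)[of x] sub[OF i] density_le_loc_max[of "n * j + i" "Suc k" I x]
        child_index_less[OF Suc.prems(1) i] Suc.prems(2) by (auto simp: max_def)
  qed (use Suc.prems in auto)
  then obtain g where g [measurable]: "\<And>i. i < n \<Longrightarrow> g i \<in> borel_measurable borel"
    and le: "\<And>i x. i < n \<Longrightarrow> g i x \<le> loc_max I w x * indicator (?J i) x"
    and int: "\<And>i. i < n \<Longrightarrow> (\<integral>\<^sup>+x. g i x \<partial>lborel) = ennreal (max_sum n density d (Suc k) (n * j + i) (max M (?x i)))"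
    and nn: "\<And>i. i < n \<Longrightarrow> 0 \<le> max_sum n density d (Suc k) (n * j + i) (max M (?x i))"
    by metis
  show ?case
  proof (intro bexI[of _ "\<lambda>x. \<Sum>i<n. g i x"] conjI allI)
    fix x
    show "(\<Sum>i<n. g i x) \<le> loc_max I w x * indicator (nadic n k j) x"
    proof -
      have "(\<Sum>i<n. g i x) \<le> (\<Sum>i<n. loc_max I w x * indicator (?J i) x)"
        by (intro sum_mono le) auto
      also have "\<dots> = loc_max I w x * (\<Sum>i<n. indicator (?J i) x)"
        by (simp add: sum_distrib_left)
      also have "(\<Sum>i<n. indicator (?J i) x) = (indicator (nadic n k j) x :: ennreal)"
        unfolding nadic_children[OF n0, of k j]
        by (intro indicator_UN_disjoint[symmetric] disjoint_nadic_children n0) auto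
      finally show ?thesis .
    qed
  next
    \<comment> \<open>Nonnegativity is carried through the induction so that \<open>ennreal\<close>
      commutes with the sum over the children.\<close>
    have "(\<integral>\<^sup>+x. (\<Sum>i<n. g i x) \<partial>lborel) = (\<Sum>i<n. \<integral>\<^sup>+x. g i x \<partial>lborel)"
      by (intro nn_integral_sum) auto
    also have "\<dots> = ennreal (max_sum n density (Suc d) k j M)"
      using nn by (simp add: int) (rule sum_ennreal, simp)
    finally show "(\<integral>\<^sup>+x. (\<Sum>i<n. g i x) \<partial>lborel) = ennreal (max_sum n density (Suc d) k j M)" .
    show "0 \<le> max_sum n density (Suc d) k j M" using nn by (auto intro: sum_nonneg)
  qed auto
qed

text \<open>Dividing the integral of the maximal function by length and average gives a member of
  the supremum \<open>Ainf_scl n w\<close>; multiplying back gives the mass.\<close>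

lemma max_sum_le_Ainf:
  assumes j: "j < n ^ k"
  shows "ennreal (max_sum n density d k j (density k j)) \<le> Ainf_scl n w * ennreal (mass k j)"
proof -
  let ?I = "nadic n k j"
  obtain g where g: "\<And>x. g x \<le> loc_max ?I w x * indicator ?I x"
    and int: "(\<integral>\<^sup>+x. g x \<partial>lborel) = ennreal (max_sum n density d k j (density k j))"
    using max_sum_minorant[OF j order_refl, of "density k j" d] density_pos[OF j]
      density_le_loc_max[OF j order_refl] by auto
  have "ennreal (max_sum n density d k j (density k j)) \<le> (\<integral>\<^sup>+x\<in>?I. loc_max ?I w x \<partial>lborel)" (is "_ \<le> ?L")
    unfolding int[symmetric] by (intro nn_integral_mono g)
  also have "\<dots> = ?L / ennreal (measure lborel ?I) / ennreal (avg w ?I) * ennreal (avg w ?I) * ennreal (measure lborel ?I)"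
    using density_pos[OF j] n0 by (simp add: ennreal_divide_mult_cancel measure_nadic flip: density_eq_avg)
  also have "\<dots> \<le> Ainf_scl n w * ennreal (avg w ?I) * ennreal (measure lborel ?I)"
    unfolding Ainf_scl_def using j
    by (intro mult_right_mono SUP_upper) (auto simp: nadic_intervals_def)
  also have "\<dots> = Ainf_scl n w * ennreal (avg w ?I * measure lborel ?I)"
    using density_pos[OF j] by (simp add: ennreal_mult mult.assoc flip: density_eq_avg)
  also have "avg w ?I * measure lborel ?I = mass k j"
    using n0 by (simp add: avg_def mass_def measure_nadic)
  finally show ?thesis .
qed

text \<open>The index map \<open>\<phi>\<close> serves two cases: a whole generation, and the
  children of one interval. Disjointness removes the cross terms of the square.\<close>

lemma step_nn_integral:
  assumes J: "finite J" "\<And>i. i \<in> J \<Longrightarrow> \<phi> i < n ^ k"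
    and disj: "disjoint_family_on (\<lambda>i. nadic n k (\<phi> i)) J"
  shows "(\<integral>\<^sup>+x\<in>{0..1}. ennreal ((\<Sum>i\<in>J. c i * indicator (nadic n k (\<phi> i)) x)\<^sup>2) * ennreal (w x) \<partial>lborel)
       = ennreal (\<Sum>i\<in>J. (c i)\<^sup>2 * mass k (\<phi> i))"
proof -
  let ?A = "\<lambda>i. nadic n k (\<phi> i)"
  have "(\<integral>\<^sup>+x\<in>{0..1}. ennreal ((\<Sum>i\<in>J. c i * indicator (?A i) x)\<^sup>2) * ennreal (w x) \<partial>lborel)
     = (\<integral>\<^sup>+x. (\<Sum>i\<in>J. ennreal ((c i)\<^sup>2) * (ennreal (w x) * indicator (?A i) x)) \<partial>lborel)"
  proof (rule nn_integral_cong)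
    fix x
    have "ennreal ((\<Sum>i\<in>J. c i * indicator (?A i) x)\<^sup>2) = (\<Sum>i\<in>J. ennreal ((c i)\<^sup>2) * indicator (?A i) x)"
    proof -
      have "ennreal ((\<Sum>i\<in>J. c i * indicator (?A i) x)\<^sup>2) = ennreal (\<Sum>i\<in>J. (c i)\<^sup>2 * indicator (?A i) x)"
        by (simp only: sum_indicator_power2[OF disj J(1)])
      also have "\<dots> = (\<Sum>i\<in>J. ennreal ((c i)\<^sup>2 * indicator (?A i) x))"
        by (rule sum_ennreal[symmetric]) simp
      also have "\<dots> = (\<Sum>i\<in>J. ennreal ((c i)\<^sup>2) * indicator (?A i) x)"
        by (intro sum.cong refl) (simp add: indicator_def)
      finally show ?thesis .
    qed
    moreover have "ennreal ((c i)\<^sup>2) * indicator (?A i) x * ennreal (w x) * indicator {0..1} x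
        = ennreal ((c i)\<^sup>2) * (ennreal (w x) * indicator (?A i) x)" if "i \<in> J" for i
      using nadic_unit[OF J(2)[OF that]] by (auto simp: indicator_def)
    ultimately show "ennreal ((\<Sum>i\<in>J. c i * indicator (?A i) x)\<^sup>2) * ennreal (w x) * indicator {0..1} x
       = (\<Sum>i\<in>J. ennreal ((c i)\<^sup>2) * (ennreal (w x) * indicator (?A i) x))"
      by (simp only: sum_distrib_right) (intro sum.cong refl)
  qed
  also have "\<dots> = (\<Sum>i\<in>J. ennreal ((c i)\<^sup>2) * (\<integral>\<^sup>+x. ennreal (w x) * indicator (?A i) x \<partial>lborel))"
    by (simp add: nn_integral_sum nn_integral_cmult)
  also have "\<dots> = (\<Sum>i\<in>J. ennreal ((c i)\<^sup>2 * mass k (\<phi> i)))"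
    using J by (intro sum.cong refl) (simp add: nn_integral_nadic ennreal_mult less_imp_le mass_pos)
  also have "\<dots> = ennreal (\<Sum>i\<in>J. (c i)\<^sup>2 * mass k (\<phi> i))"
    using J mass_pos by (intro sum_ennreal) (simp add: less_imp_le)
  finally show ?thesis .
qed

end

section \<open>Averages and square function of a fixed function\<close>

context nadic_weight
begin

context
  fixes f :: "real \<Rightarrow> real"
  assumes f_int: "set_integrable lborel {0..1} f"
begin

abbreviation "F k j \<equiv> avg f (nadic n k j)"
abbreviation "sq_int \<equiv> \<integral>\<^sup>+x\<in>{0..1}. (sq_fun n f x)\<^sup>2 * ennreal (w x) \<partial>lborel"

lemma avg_mean:
  assumes "j < n ^ k" shows "(\<Sum>i<n. F (Suc k) (n * j + i)) = real n * F k j"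
  using n0 by (simp add: avg_def measure_nadic set_integral_children[OF f_int assms] sum_distrib_right mult_ac
      flip: sum_distrib_left)

text \<open>The children partition the parent, so its term is spread over them; in this form
  \<open>step_nn_integral\<close> applies.\<close>

lemma mart_diff_eq:
  "mart_diff n k j f x = (\<Sum>i<n. (F (Suc k) (n * j + i) - F k j) * indicator (nadic n (Suc k) (n * j + i)) x)"
proof -
  have "indicator (nadic n k j) x = (\<Sum>i<n. indicator (nadic n (Suc k) (n * j + i)) x :: real)"
    unfolding nadic_children[OF n0, of k j]
    by (intro indicator_UN_disjoint disjoint_nadic_children n0) auto
  then show ?thesis
    by (simp only: mart_diff_def left_diff_distrib sum_subtractf sum_distrib_left)
qed

lemma borel_measurable_mart_diff [measurable]: "mart_diff n k j f \<in> borel_measurable borel"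
  unfolding mart_diff_def by measurable

lemma sq_int_eq:
  "sq_int = (\<Sum>k. ennreal (\<Sum>j<n ^ k. \<Sum>i<n. (F (Suc k) (n * j + i) - F k j)\<^sup>2 * mass (Suc k) (n * j + i)))"
proof -
  have "sq_int = (\<integral>\<^sup>+x. (\<Sum>k. \<Sum>j<n ^ k. ennreal ((mart_diff n k j f x)\<^sup>2) * ennreal (w x) * indicator {0..1} x) \<partial>lborel)"
    by (simp only: sq_fun_def esqrt_power2 sq_fun_sq_def sum_distrib_right
        flip: ennreal_suminf_multc)
  also have "\<dots> = (\<Sum>k. \<Sum>j<n ^ k. \<integral>\<^sup>+x\<in>{0..1}. ennreal ((mart_diff n k j f x)\<^sup>2) * ennreal (w x) \<partial>lborel)"
    by (subst nn_integral_suminf) (auto intro!: suminf_cong nn_integral_sum simp del: sum_mult_indicator)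
  also have "\<dots> = (\<Sum>k. \<Sum>j<n ^ k. ennreal (\<Sum>i<n. (F (Suc k) (n * j + i) - F k j)\<^sup>2 * mass (Suc k) (n * j + i)))"
    unfolding mart_diff_eq
    by (intro suminf_cong sum.cong refl step_nn_integral disjoint_nadic_children n0 child_index_less) auto
  also have "\<dots> = (\<Sum>k. ennreal (\<Sum>j<n ^ k. \<Sum>i<n. (F (Suc k) (n * j + i) - F k j)\<^sup>2 * mass (Suc k) (n * j + i)))"
    by (intro suminf_cong sum_ennreal sum_nonneg mult_nonneg_nonneg less_imp_le[OF child_pos]) auto
  finally show ?thesis .
qed

lemma expectation_nn_integral:
  "(\<integral>\<^sup>+x\<in>{0..1}. ennreal ((nadic_expectation n N f x)\<^sup>2) * ennreal (w x) \<partial>lborel)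
     = ennreal (\<Sum>l<n ^ N. (F N l)\<^sup>2 * mass N l)"
  unfolding nadic_expectation_def by (intro step_nn_integral disjoint_nadic n0) auto

lemma expectation_bound:
  assumes f0: "(LINT x:{0..1}|lborel. f x) = 0"
  shows "ennreal (\<Sum>l<n ^ N. (F N l)\<^sup>2 * mass N l) \<le> ennreal ((20 * real n)\<^sup>2) * Ainf_scl n w * sq_int"
proof -
  let ?s = "\<lambda>k. \<Sum>j<n ^ k. \<Sum>i<n. (F (Suc k) (n * j + i) - F k j)\<^sup>2 * mass (Suc k) (n * j + i)"
  have s_nn: "0 \<le> ?s k" for k
    by (intro sum_nonneg mult_nonneg_nonneg less_imp_le[OF child_pos]) auto
  have F0: "F 0 0 = 0"
  proof -
    \<comment> \<open>Generation 0 is [0,1), which differs from [0,1] by the null set {1}.\<close>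
    have "(LINT x:nadic n 0 0|lborel. f x) = (LINT x:{0..1}|lborel. f x)"
    proof (rule set_integral_cong_set)
      show "set_borel_measurable lborel (nadic n 0 0) f" "set_borel_measurable lborel {0..1} f"
        using f_int set_integrable_nadic[OF f_int, of 0 0]
        by (auto simp: set_integrable_def set_borel_measurable_def)
      show "AE x in lborel. x \<in> {0..1} \<longleftrightarrow> x \<in> nadic n 0 0"
        using AE_lborel_singleton[of "1::real"] by eventually_elim (auto simp: nadic_def)
    qed
    then show ?thesis by (simp add: avg_def f0)
  qed
  show ?thesis
  \<comment> \<open>A zero square function is treated apart: with an infinite characteristic the
    right side would be top * 0 = 0, so the left side has to be shown to vanish.\<close>
  proof (cases "sq_int = 0")
    case True
    then have "(\<Sum>k. ennreal (?s k)) = 0" by (simp only: sq_int_eq)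
    then have s0: "?s k = 0" for k
      using s_nn[of k] by (simp add: suminf_eq_zero_iff ennreal_eq_0_iff order_antisym)
    \<comment> \<open>All masses are positive, so each child average equals that of its parent, and
      the value 0 at the root spreads downwards.\<close>
    have "\<forall>l<n ^ N. F N l = 0" for N
    proof (induction N)
      case 0
      then show ?case using F0 by simp
    next
      case (Suc k)
      show ?case
      proof (intro allI impI)
        fix l assume l: "l < n ^ Suc k"
        define j i where "j = l div n" and "i = l mod n"
        have ji: "l = n * j + i" "i < n" using n0 by (auto simp: j_def i_def)
        have j: "j < n ^ k" using l n0 by (simp add: j_def div_less_iff_less_mult mult.commute)
        have "(\<Sum>i<n. (F (Suc k) (n * j + i) - F k j)\<^sup>2 * mass (Suc k) (n * j + i)) = 0"
          using s0[of k] j by (subst (asm) sum_nonneg_eq_0_iff)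
            (auto intro!: sum_nonneg mult_nonneg_nonneg less_imp_le[OF child_pos])
        then have "(F (Suc k) (n * j + i) - F k j)\<^sup>2 * mass (Suc k) (n * j + i) = 0"
          using ji j by (subst (asm) sum_nonneg_eq_0_iff)
            (auto intro!: mult_nonneg_nonneg less_imp_le[OF child_pos])
        then show "F (Suc k) l = 0" using child_pos[OF j ji(2)] Suc j ji(1) by auto
      qed
    qed
    then show ?thesis by simp
  next
    case nz: False
    show ?thesis
    proof (cases "Ainf_scl n w")
      case top
      then show ?thesis using nz n0 by (simp add: ennreal_mult_top ennreal_top_mult)
    next
      case (real a)
      have max_le: "max_sum n density d k j (density k j) \<le> a * mass k j" if "j < n ^ k" for d k j
      proof -
        have "ennreal (max_sum n density d k j (density k j)) \<le> ennreal (a * mass k j)"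
          using max_sum_le_Ainf[OF that, of d] mass_pos[OF that] real by (simp add: ennreal_mult less_imp_le)
        then show ?thesis using real mass_pos[OF that] by (subst (asm) ennreal_le_iff) (auto simp: less_imp_le)
      qed
      \<comment> \<open>Depth 0 at the root compares the total mass with \<open>a\<close> times
        itself.\<close>
      have "mass 0 0 \<le> a * mass 0 0" using max_le[of 0 0 0] by (simp add: density_def)
      then have a1: "1 \<le> a" using mass_pos[of 0 0] by simp
      \<comment> \<open>The Carleson constant is A = 32 n a: the factor 32 n comes from
        \<open>tree_sum_child_osc_le\<close>, the factor a from \<open>max_le\<close>.\<close>
      have "(\<Sum>l<n ^ N. (F N l)\<^sup>2 * mass N l) \<le> (2 + 8 * (32 * real n * a)) * (\<Sum>k<N. ?s k)"
      proof (rule square_function_lower_bound)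
        show "0 < 32 * real n * a" using a1 n0 by simp
        show "tree_sum n child_osc d k j \<le> 32 * real n * a * mass k j" if "j < n ^ k" for d k j
        proof -
          have "32 * real n * max_sum n density d k j (density k j) \<le> 32 * real n * (a * mass k j)"
            by (intro mult_left_mono max_le that) auto
          then show ?thesis using tree_sum_child_osc_le[OF that, of d] by simp
        qed
      qed (use avg_mean F0 in auto)
      \<comment> \<open>Since n, a >= 1, 2 + 256 n a <= 258 n a <= 400 n^2 a.\<close>
      also have "\<dots> \<le> ((20 * real n)\<^sup>2 * a) * (\<Sum>k<N. ?s k)"
      proof (intro mult_right_mono sum_nonneg[OF s_nn])
        have n1: "1 \<le> real n" using n0 by simp
        have "1 * 1 \<le> real n * a" using n1 a1 by (intro mult_mono) auto
        moreover have "1 * (real n * a) \<le> real n * (real n * a)"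
          using n1 a1 by (intro mult_right_mono) auto
        ultimately show "2 + 8 * (32 * real n * a) \<le> (20 * real n)\<^sup>2 * a"
          by (simp add: power2_eq_square)
      qed
      finally have "ennreal (\<Sum>l<n ^ N. (F N l)\<^sup>2 * mass N l) \<le> ennreal (((20 * real n)\<^sup>2 * a) * (\<Sum>k<N. ?s k))"
        by (rule ennreal_leI)
      also have "\<dots> = ennreal ((20 * real n)\<^sup>2) * Ainf_scl n w * (\<Sum>k<N. ennreal (?s k))"
        using real s_nn by (simp add: ennreal_mult sum_nonneg sum_ennreal)
      also have "\<dots> \<le> ennreal ((20 * real n)\<^sup>2) * Ainf_scl n w * sq_int"
        unfolding sq_int_eq by (intro mult_left_mono sum_le_suminf) auto
      finally show ?thesis .
    qed
  qed
qed

lemma weighted_bound: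
  assumes f_meas [measurable]: "f \<in> borel_measurable borel" and f0: "(LINT x:{0..1}|lborel. f x) = 0"
  shows "(\<integral>\<^sup>+x\<in>{0..1}. ennreal ((f x)\<^sup>2) * ennreal (w x) \<partial>lborel)
     \<le> ennreal ((20 * real n)\<^sup>2) * Ainf_scl n w * sq_int"
proof -
  let ?g = "\<lambda>N x. ennreal ((nadic_expectation n N f x)\<^sup>2) * ennreal (w x) * indicator {0..1} x"
  have [measurable]: "nadic_expectation n N f \<in> borel_measurable borel" for N
    unfolding nadic_expectation_def by measurable
  have "(\<integral>\<^sup>+x\<in>{0..1}. ennreal ((f x)\<^sup>2) * ennreal (w x) \<partial>lborel) \<le> (\<integral>\<^sup>+x. liminf (\<lambda>N. ?g N x) \<partial>lborel)"
  proof (rule nn_integral_mono_AE)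
    show "AE x in lborel. ennreal ((f x)\<^sup>2) * ennreal (w x) * indicator {0..1} x \<le> liminf (\<lambda>N. ?g N x)"
      using nadic_expectation_tendsto[OF n2 f_int]
    proof eventually_elim
      fix x assume x: "x \<in> {0..1} \<longrightarrow> (\<lambda>N. nadic_expectation n N f x) \<longlonglongrightarrow> f x"
      show "ennreal ((f x)\<^sup>2) * ennreal (w x) * indicator {0..1} x \<le> liminf (\<lambda>N. ?g N x)"
      proof (cases "x \<in> {0..1}")
        case True
        \<comment> \<open>The product is formed in the reals, where multiplication is continuous,
          before \<open>ennreal\<close> is applied.\<close>
        then have "(\<lambda>N. ennreal ((nadic_expectation n N f x)\<^sup>2 * w x)) \<longlonglongrightarrow> ennreal ((f x)\<^sup>2 * w x)"
          using x by (intro tendsto_ennrealI tendsto_intros) auto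
        then have "(\<lambda>N. ?g N x) \<longlonglongrightarrow> ennreal ((f x)\<^sup>2) * ennreal (w x) * indicator {0..1} x"
          using True by (simp add: ennreal_mult')
        then show ?thesis by (simp add: lim_imp_Liminf)
      qed simp
    qed
  qed
  also have "\<dots> \<le> liminf (\<lambda>N. \<integral>\<^sup>+x. ?g N x \<partial>lborel)"
    by (intro nn_integral_liminf) auto
  also have "\<dots> \<le> limsup (\<lambda>N. \<integral>\<^sup>+x. ?g N x \<partial>lborel)"
    by (rule Liminf_le_Limsup) simp
  also have "\<dots> \<le> ennreal ((20 * real n)\<^sup>2) * Ainf_scl n w * sq_int"
    unfolding expectation_nn_integral
    by (intro Limsup_bounded always_eventually allI expectation_bound[OF f0])
  finally show ?thesis .
qed

end

end

theorem theorem3p4: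
  shows "\<exists>C::real. \<forall>(n::nat) (w::real \<Rightarrow> real) (f::real \<Rightarrow> real).
     n \<ge> 2
     \<and> w \<in> borel_measurable lborel \<and> set_integrable lborel {0..1} w
     \<and> (AE x in lborel. x \<in> {0..1} \<longrightarrow> w x > 0)
     \<and> f \<in> borel_measurable lborel
     \<and> (\<integral>\<^sup>+ x\<in>{0..1}. ennreal ((f x)\<^sup>2 * w x) \<partial>lborel) < \<infinity>
     \<and> set_integrable lborel {0..1} f
     \<and> (\<integral>x\<in>{0..1}. f x \<partial>lborel) = 0
     \<longrightarrow> L2w_norm w (\<lambda>x. ennreal \<bar>f x\<bar>)
           \<le> ennreal (C * real n) * esqrt (Ainf_scl n w) * L2w_norm w (sq_fun n f)"
proof (intro exI[of _ 20] allI impI, elim conjE)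
  fix n :: nat and w f :: "real \<Rightarrow> real"
  assume n: "n \<ge> 2" and w: "w \<in> borel_measurable lborel" "set_integrable lborel {0..1} w"
    "AE x in lborel. x \<in> {0..1} \<longrightarrow> w x > 0"
    and f: "f \<in> borel_measurable lborel" "set_integrable lborel {0..1} f" "(\<integral>x\<in>{0..1}. f x \<partial>lborel) = 0"
  interpret nadic_weight n w
    by unfold_locales (use n w in auto)
  have "(\<integral>\<^sup>+x\<in>{0..1}. (ennreal \<bar>f x\<bar>)\<^sup>2 * ennreal (w x) \<partial>lborel)
      \<le> ennreal ((20 * real n)\<^sup>2) * Ainf_scl n w * (\<integral>\<^sup>+x\<in>{0..1}. (sq_fun n f x)\<^sup>2 * ennreal (w x) \<partial>lborel)"
    using weighted_bound[OF f(2)] f by (simp add: ennreal_power)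
  \<comment> \<open>The estimate between squares passes through the monotone and multiplicative
    \<open>esqrt\<close>; the root of (20 n)^2 explains the witness 20.\<close>
  then show "L2w_norm w (\<lambda>x. ennreal \<bar>f x\<bar>)
           \<le> ennreal (20 * real n) * esqrt (Ainf_scl n w) * L2w_norm w (sq_fun n f)"
    unfolding L2w_norm_def esqrt_ennreal_power2[OF mult_nonneg_nonneg[OF zero_le_numeral of_nat_0_le_iff], symmetric]
    by (simp only: esqrt_mono flip: esqrt_mult)
qed

end
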